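(* Let $n\geq2$, let $M$ be a finite monoid with group of units $G$, and suppose that $M/\mathscr L$ is a chain. Then $$\mathrm{rank}(M\wr\mathrm{Sing}_n)=\begin{cases}2&\text{if }n=2\text{ and }|M|=1,\\ (2|M|-|G|)\binom n2&\text{otherwise,}\end{cases}$$ and $$\mathrm{idrank}(M\wr\mathrm{Sing}_n)=\begin{cases}2|M|&\text{if }n=2\text{ and }|G|=1,\\ (2|M|-|G|)\binom n2&\text{otherwise.}\end{cases}$$
   Context: $\mathcal T_n$ is the monoid of all maps $\{1,\ldots,n\}\to\{1,\ldots,n\}$, written on the right and composed from left to right, and $\mathrm{Sing}_n$ is its subsemigroup of all non-bijective maps. The wreath product $M\wr\mathrm{Sing}_n$ is the set $M^n\times\mathrm{Sing}_n$ with product $$((a_1,\ldots,a_n),\alpha)((b_1,\ldots,b_n),\beta)=((a_1b_{1\alpha},\ldots,a_nb_{n\alpha}),\alpha\beta).$$ The rank of a semigroup $T$, $\mathrm{rank}(T)$, is the smallest cardinality of a set generating $T$ as a semigroup; if $T$ is generated by its idempotents, $\mathrm{idrank}(T)$ is the smallest cardinality of a generating set for $T$ consisting of idempotents. (When $M/\mathscr L$ is a chain, $M\wr\mathrm{Sing}_n$ is idempotent-generated.) On $M$, $a\leq_{\mathscr L}b$ means $a\in Mb$; $\mathscr L$ is the equivalence $\leq_{\mathscr L}\cap\geq_{\mathscr L}$, and $M/\mathscr L$ is the set of $\mathscr L$-classes with the partial order induced by $\leq_{\mathscr L}$. *)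

theory Defs
  imports
    "HOL-Algebra.Group"
    "HOL-Library.FuncSet"
    "HOL-Library.Extended_Nat"
begin

section \<open>Rank and idempotent rank\<close>

text \<open>A semigroup is given by a carrier \<open>S\<close> and a binary operation \<open>f\<close>, since
  \<open>HOL-Algebra\<close> has no record for semigroups without identity.\<close>

inductive_set semigroup_generated :: "('a \<Rightarrow> 'a \<Rightarrow> 'a) \<Rightarrow> 'a set \<Rightarrow> 'a set"
  for f :: "'a \<Rightarrow> 'a \<Rightarrow> 'a" and A :: "'a set"
  where
    incl: "x \<in> A \<Longrightarrow> x \<in> semigroup_generated f A"
  | mult: "x \<in> semigroup_generated f A \<Longrightarrow> y \<in> semigroup_generated f A
      \<Longrightarrow> f x y \<in> semigroup_generated f A"

definition generates_semigroup :: "'a set \<Rightarrow> ('a \<Rightarrow> 'a \<Rightarrow> 'a) \<Rightarrow> 'a set \<Rightarrow> bool" where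
  "generates_semigroup S f A \<longleftrightarrow> A \<subseteq> S \<and> semigroup_generated f A = S"

definition semigroup_idempotents :: "'a set \<Rightarrow> ('a \<Rightarrow> 'a \<Rightarrow> 'a) \<Rightarrow> 'a set" where
  "semigroup_idempotents S f = {e \<in> S. f e e = e}"

text \<open>The infimum is \<open>\<infinity>\<close> if there is no finite generating set of the required kind.
  If it is finite, it is attained. In particular, a finite value of
  \<open>semigroup_idrank S f\<close> implies that the semigroup is generated by its idempotents.\<close>

definition semigroup_rank :: "'a set \<Rightarrow> ('a \<Rightarrow> 'a \<Rightarrow> 'a) \<Rightarrow> enat" where
  "semigroup_rank S f = (INF A \<in> {A. finite A \<and> generates_semigroup S f A}. enat (card A))"

definition semigroup_idrank :: "'a set \<Rightarrow> ('a \<Rightarrow> 'a \<Rightarrow> 'a) \<Rightarrow> enat" where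
  "semigroup_idrank S f =
    (INF A \<in> {A. finite A \<and> A \<subseteq> semigroup_idempotents S f \<and> generates_semigroup S f A}.
      enat (card A))"


section \<open>The ordered set of \<open>\<L>\<close>-classes of a monoid\<close>

definition L_le :: "('a, 'm) monoid_scheme \<Rightarrow> 'a \<Rightarrow> 'a \<Rightarrow> bool" where
  "L_le M a b \<longleftrightarrow> (\<exists>x \<in> carrier M. a = x \<otimes>\<^bsub>M\<^esub> b)"

definition L_rel :: "('a, 'm) monoid_scheme \<Rightarrow> 'a rel" where
  "L_rel M = {(a, b). a \<in> carrier M \<and> b \<in> carrier M \<and> L_le M a b \<and> L_le M b a}"

definition L_classes :: "('a, 'm) monoid_scheme \<Rightarrow> 'a set set" where
  "L_classes M = carrier M // L_rel M"

definition L_order :: "('a, 'm) monoid_scheme \<Rightarrow> 'a set rel" where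
  "L_order M = {(C, D). C \<in> L_classes M \<and> D \<in> L_classes M \<and> (\<exists>a \<in> C. \<exists>b \<in> D. L_le M a b)}"

definition L_chain :: "('a, 'm) monoid_scheme \<Rightarrow> bool" where
  "L_chain M \<longleftrightarrow> linear_order_on (L_classes M) (L_order M)"

lemma (in monoid) L_le_refl: "a \<in> carrier G \<Longrightarrow> L_le G a a"
  unfolding L_le_def by (metis l_one one_closed)

lemma (in monoid) L_le_trans:
  "c \<in> carrier G \<Longrightarrow> L_le G a b \<Longrightarrow> L_le G b c \<Longrightarrow> L_le G a c"
  unfolding L_le_def by (metis m_assoc m_closed)

lemma (in monoid) equiv_L_rel: "equiv (carrier G) (L_rel G)"
proof (rule equivI)
  show "L_rel G \<subseteq> carrier G \<times> carrier G"
    by (auto simp: L_rel_def)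
  show "refl_on (carrier G) (L_rel G)"
    by (auto simp: L_rel_def refl_on_def L_le_refl)
  show "sym (L_rel G)"
    by (auto simp: L_rel_def sym_def)
  show "trans (L_rel G)"
  proof (rule transI)
    fix a b c assume "(a, b) \<in> L_rel G" "(b, c) \<in> L_rel G"
    then show "(a, c) \<in> L_rel G"
      using L_le_trans[of c a b] L_le_trans[of a c b] by (simp add: L_rel_def)
  qed
qed

lemma (in monoid) L_order_iff:
  assumes "a \<in> carrier G" "b \<in> carrier G"
  shows "(L_rel G `` {a}, L_rel G `` {b}) \<in> L_order G \<longleftrightarrow> L_le G a b"
proof
  assume "(L_rel G `` {a}, L_rel G `` {b}) \<in> L_order G"
  then obtain a' b' where *: "(a, a') \<in> L_rel G" "(b, b') \<in> L_rel G" "L_le G a' b'"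
    by (auto simp: L_order_def)
  then have "L_le G a b'"
    using L_le_trans[of b' a a'] by (simp add: L_rel_def)
  then show "L_le G a b"
    using * assms L_le_trans[of b a b'] by (simp add: L_rel_def)
next
  assume "L_le G a b"
  moreover have "a \<in> L_rel G `` {a}" "b \<in> L_rel G `` {b}"
    using assms L_le_refl by (simp_all add: L_rel_def)
  ultimately show "(L_rel G `` {a}, L_rel G `` {b}) \<in> L_order G"
    using assms unfolding L_order_def L_classes_def by (blast intro: quotientI)
qed

text \<open>The induced relation is always a partial order, so \<open>L_chain\<close> only demands
  comparability of any two \<open>\<L>\<close>-classes.\<close>

lemma (in monoid) partial_order_on_L_order: "partial_order_on (L_classes G) (L_order G)"
proof -
  have rep: "\<exists>a \<in> carrier G. C = L_rel G `` {a}" if "C \<in> L_classes G" for C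
    using that by (auto simp: L_classes_def quotient_def)
  have sub: "C \<in> L_classes G \<and> D \<in> L_classes G" if "(C, D) \<in> L_order G" for C D
    using that by (auto simp: L_order_def)
  have "refl_on (L_classes G) (L_order G)"
    using rep L_order_iff L_le_refl by (metis refl_onI)
  moreover have "L_order G \<subseteq> L_classes G \<times> L_classes G"
    using sub by auto
  moreover have "trans (L_order G)"
  proof (rule transI)
    fix C D E assume *: "(C, D) \<in> L_order G" "(D, E) \<in> L_order G"
    then obtain a b c where "a \<in> carrier G" "C = L_rel G `` {a}" "b \<in> carrier G"
      "D = L_rel G `` {b}" "c \<in> carrier G" "E = L_rel G `` {c}"
      using rep sub by metis
    then show "(C, E) \<in> L_order G"
      using * L_order_iff L_le_trans[of c a b] by simp
  qed
  moreover have "antisym (L_order G)"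
  proof (rule antisymI)
    fix C D assume *: "(C, D) \<in> L_order G" "(D, C) \<in> L_order G"
    then obtain a b where ab: "a \<in> carrier G" "C = L_rel G `` {a}" "b \<in> carrier G"
      "D = L_rel G `` {b}"
      using rep sub by metis
    then have "(a, b) \<in> L_rel G"
      using * L_order_iff by (auto simp: L_rel_def)
    then show "C = D"
      using ab equiv_class_eq[OF equiv_L_rel] by simp
  qed
  ultimately show ?thesis
    by (auto simp: partial_order_on_def preorder_on_def)
qed


section \<open>The wreath product with the singular transformations\<close>

text \<open>Maps on \<open>{1..n}\<close> and \<open>n\<close>-tuples are extensional functions. Transformations act on
  the right: \<open>i\<alpha>\<close> is \<open>\<alpha> i\<close>, and the product \<open>\<alpha>\<beta>\<close> is \<open>compose {1..n} \<beta> \<alpha>\<close>, first \<open>\<alpha>\<close> and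
  then \<open>\<beta>\<close>.\<close>

definition full_transformations :: "nat \<Rightarrow> (nat \<Rightarrow> nat) set" where
  "full_transformations n = {1..n} \<rightarrow>\<^sub>E {1..n}"

definition Sing :: "nat \<Rightarrow> (nat \<Rightarrow> nat) set" where
  "Sing n = {\<alpha> \<in> full_transformations n. \<not> bij_betw \<alpha> {1..n} {1..n}}"

definition wreath_Sing_carrier ::
  "('a, 'm) monoid_scheme \<Rightarrow> nat \<Rightarrow> ((nat \<Rightarrow> 'a) \<times> (nat \<Rightarrow> nat)) set" where
  "wreath_Sing_carrier M n = ({1..n} \<rightarrow>\<^sub>E carrier M) \<times> Sing n"

definition wreath_mult ::
  "('a, 'm) monoid_scheme \<Rightarrow> nat \<Rightarrow> (nat \<Rightarrow> 'a) \<times> (nat \<Rightarrow> nat)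
    \<Rightarrow> (nat \<Rightarrow> 'a) \<times> (nat \<Rightarrow> nat) \<Rightarrow> (nat \<Rightarrow> 'a) \<times> (nat \<Rightarrow> nat)" where
  "wreath_mult M n = (\<lambda>(a, \<alpha>) (b, \<beta>).
    (\<lambda>i \<in> {1..n}. a i \<otimes>\<^bsub>M\<^esub> b (\<alpha> i), compose {1..n} \<beta> \<alpha>))"

end

theory Submission
  imports Defs
begin

text \<open>Let \<open>\<epsilon> i j a\<close> be the idempotent that moves \<open>j\<close> to \<open>i\<close> with weight \<open>a\<close> and fixes all other
  points with weight \<open>1\<close>. Multiplying on the right by \<open>\<epsilon> i j a\<close> an element whose image misses
  \<open>i\<close> slides the item at \<open>j\<close> into the hole \<open>i\<close>. If \<open>M/\<L>\<close> is a chain, an element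
  identifying \<open>i\<close> and \<open>j\<close> has the form \<open>\<epsilon> j i x s\<close> (up to swapping \<open>i\<close> and \<open>j\<close>), where only
  the values of \<open>s\<close> off \<open>i\<close> matter; these can be produced by sliding, so the \<open>\<epsilon> i j a\<close> generate.

  For the lower bound, the first factor of a product equal to \<open>\<epsilon> i j a\<close> has kernel
  \<open>{i, j}\<close>, a unit \<open>b\<^sub>i\<close> in position \<open>i\<close>, and \<open>a b\<^sub>i\<close> in position \<open>j\<close>. So it determines
  \<open>\<epsilon> i j a\<close> up to the coincidence of \<open>\<epsilon> i j g\<close> with \<open>\<epsilon> j i g\<^sup>-\<^sup>1\<close> for units \<open>g\<close>.
  The bound is attained because one of each such pair can be recovered from the other:
  by going around a 3-cycle if \<open>n \<ge> 3\<close>, or by using a nontrivial unit.\<close>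

section \<open>Preliminaries on counting, finite monoids and generated semigroups\<close>

lemma card_increasing_pairs: "card {(i, j). 1 \<le> i \<and> i < j \<and> j \<le> n} = n choose 2"
proof -
  \<comment> \<open>Sorted by the larger entry \<open>j\<close>, the pairs leave
    \<open>j - 1\<close> choices for the smaller one.\<close>
  have "{(i, j). 1 \<le> i \<and> i < j \<and> j \<le> n} = prod.swap ` (SIGMA j:{1..n}. {1..<j})"
    by force
  then have "card {(i, j). 1 \<le> i \<and> i < j \<and> j \<le> n} = (\<Sum>j\<in>{1..n}. j - 1)"
    by (simp add: card_image)
  also have "\<dots> = \<Sum>{..<n}"
    by (rule sum.reindex_bij_witness[of _ Suc "\<lambda>j. j - 1"]) auto
  also have "\<dots> = n choose 2"
    by (induction n) (auto simp: numeral_2_eq_2)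
  finally show ?thesis .
qed

text \<open>Right multiplication by \<open>a\<close> is injective, since right multiplication by
  \<open>c\<close> undoes it. By finiteness it is onto and reaches \<open>\<one>\<close>, so
  \<open>a\<close> also has a left inverse.\<close>

lemma (in monoid) finite_right_inverse_Units:
  assumes "finite (carrier G)" "a \<in> carrier G" "c \<in> carrier G" "a \<otimes> c = \<one>"
  shows "a \<in> Units G"
proof -
  have "inj_on (\<lambda>x. x \<otimes> a) (carrier G)"
    by (rule inj_on_inverseI[of _ "\<lambda>y. y \<otimes> c"]) (use assms in \<open>simp add: m_assoc\<close>)
  then have "(\<lambda>x. x \<otimes> a) ` carrier G = carrier G"
    using assms by (intro endo_inj_surj) auto
  then obtain y where y: "y \<in> carrier G" "y \<otimes> a = \<one>"
    using one_closed by (metis imageE)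
  then have "y = c"
    using assms inv_unique by metis
  then show ?thesis
    using assms y unfolding Units_def by blast
qed

lemma semigroup_generated_subset:
  assumes "A \<subseteq> T" "\<And>x y. x \<in> T \<Longrightarrow> y \<in> T \<Longrightarrow> f x y \<in> T"
  shows "semigroup_generated f A \<subseteq> T"
proof
  fix x assume "x \<in> semigroup_generated f A"
  then show "x \<in> T"
    by induction (use assms in auto)
qed

lemma semigroup_idempotents_iff: "x \<in> semigroup_idempotents S f \<longleftrightarrow> x \<in> S \<and> f x x = x"
  by (simp add: semigroup_idempotents_def)

section \<open>Computing in the wreath product\<close>

locale finite_monoid_wreath = monoid M
  for M :: "('a, 'm) monoid_scheme" (structure) +
  fixes n :: nat
  assumes finite_carrier: "finite (carrier M)" and n_ge_2: "n \<ge> 2"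
begin

abbreviation wreath (\<open>W\<close>) where "W \<equiv> wreath_Sing_carrier M n"

abbreviation mult_wreath (infixl \<open>\<star>\<close> 70) where "x \<star> y \<equiv> wreath_mult M n x y"

abbreviation "gen \<equiv> semigroup_generated (wreath_mult M n)"

definition \<epsilon> :: "nat \<Rightarrow> nat \<Rightarrow> 'a \<Rightarrow> (nat \<Rightarrow> 'a) \<times> (nat \<Rightarrow> nat)" where
  "\<epsilon> i j a = (\<lambda>k\<in>{1..n}. if k = j then a else \<one>, \<lambda>k\<in>{1..n}. if k = j then i else k)"

lemma fst_\<epsilon> [simp]: "k \<in> {1..n} \<Longrightarrow> fst (\<epsilon> i j a) k = (if k = j then a else \<one>)"
  and snd_\<epsilon> [simp]: "k \<in> {1..n} \<Longrightarrow> snd (\<epsilon> i j a) k = (if k = j then i else k)"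
  by (simp_all add: \<epsilon>_def)

lemma fst_mult [simp]: "k \<in> {1..n} \<Longrightarrow> fst (x \<star> y) k = fst x k \<otimes> fst y (snd x k)"
  and snd_mult [simp]: "k \<in> {1..n} \<Longrightarrow> snd (x \<star> y) k = snd y (snd x k)"
  by (simp_all add: wreath_mult_def case_prod_unfold compose_def)

text \<open>An injective self-map of a finite set is bijective, so singularity amounts to a pair of
  identified points.\<close>

lemma mem_W_iff:
  "x \<in> W \<longleftrightarrow> fst x \<in> {1..n} \<rightarrow>\<^sub>E carrier M \<and> snd x \<in> {1..n} \<rightarrow>\<^sub>E {1..n} \<and>
    (\<exists>i\<in>{1..n}. \<exists>j\<in>{1..n}. i \<noteq> j \<and> snd x i = snd x j)"
proof -
  have "bij_betw \<alpha> {1..n} {1..n} \<longleftrightarrow> inj_on \<alpha> {1..n}" if "\<alpha> \<in> {1..n} \<rightarrow>\<^sub>E {1..n}" for \<alpha>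
    using that endo_inj_surj[of "{1..n}" \<alpha>] by (auto simp: bij_betw_def)
  then show ?thesis
    unfolding wreath_Sing_carrier_def Sing_def full_transformations_def mem_Times_iff mem_Collect_eq
    by (metis inj_on_def)
qed

lemma W_weight [simp, intro]: "x \<in> W \<Longrightarrow> k \<in> {1..n} \<Longrightarrow> fst x k \<in> carrier M"
  and W_map: "x \<in> W \<Longrightarrow> k \<in> {1..n} \<Longrightarrow> snd x k \<in> {1..n}"
  by (auto simp only: mem_W_iff PiE_iff)

lemma W_eqI:
  assumes "x \<in> W" "y \<in> W"
    and "\<And>k. k \<in> {1..n} \<Longrightarrow> fst x k = fst y k" "\<And>k. k \<in> {1..n} \<Longrightarrow> snd x k = snd y k"
  shows "x = y"
  using assms by (intro prod_eqI; intro PiE_ext[of _ "{1..n}"]) (auto simp only: mem_W_iff)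

lemma mult_closed:
  assumes "x \<in> W" "y \<in> W"
  shows "x \<star> y \<in> W"
proof -
  have "fst (x \<star> y) \<in> {1..n} \<rightarrow>\<^sub>E carrier M" "snd (x \<star> y) \<in> {1..n} \<rightarrow>\<^sub>E {1..n}"
    using assms W_map
    by (auto simp: wreath_mult_def case_prod_unfold compose_def intro!: m_closed W_weight W_map
        simp del: atLeastAtMost_iff)
  moreover obtain i j where "i \<in> {1..n}" "j \<in> {1..n}" "i \<noteq> j" "snd x i = snd x j"
    using assms(1) unfolding mem_W_iff by blast
  moreover from this have "snd (x \<star> y) i = snd (x \<star> y) j"
    by (simp del: atLeastAtMost_iff)
  ultimately show ?thesis
    unfolding mem_W_iff by blast
qed

lemma \<epsilon>_in_W:
  assumes "i \<in> {1..n}" "j \<in> {1..n}" "i \<noteq> j" "a \<in> carrier M"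
  shows "\<epsilon> i j a \<in> W"
proof -
  have "\<exists>i'\<in>{1..n}. \<exists>j'\<in>{1..n}. i' \<noteq> j' \<and> snd (\<epsilon> i j a) i' = snd (\<epsilon> i j a) j'"
    using assms by (intro bexI[of _ i] bexI[of _ j]) (auto simp del: atLeastAtMost_iff)
  then show ?thesis
    using assms by (auto simp: mem_W_iff \<epsilon>_def)
qed

lemma \<epsilon>_idempotent:
  assumes "i \<in> {1..n}" "j \<in> {1..n}" "i \<noteq> j" "a \<in> carrier M"
  shows "\<epsilon> i j a \<in> semigroup_idempotents W (wreath_mult M n)"
proof -
  have "\<epsilon> i j a \<star> \<epsilon> i j a = \<epsilon> i j a"
    by (rule W_eqI) (use assms in \<open>auto simp: mult_closed \<epsilon>_in_W simp del: atLeastAtMost_iff\<close>)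
  then show ?thesis
    using assms by (simp add: semigroup_idempotents_iff \<epsilon>_in_W)
qed

lemma gen_subset_W: "A \<subseteq> W \<Longrightarrow> gen A \<subseteq> W"
  by (intro semigroup_generated_subset) (auto intro: mult_closed)


section \<open>Generation by the idempotents of defect one\<close>

text \<open>The induction is on the number of points other than the hole \<open>i\<close> that \<open>\<beta>\<close> moves or to which
  \<open>b\<close> gives a weight other than \<open>1\<close>.\<close>

lemma agree_off_hole:
  assumes S: "\<And>i j a. i \<in> {1..n} \<Longrightarrow> j \<in> {1..n} \<Longrightarrow> i \<noteq> j \<Longrightarrow> a \<in> carrier M \<Longrightarrow> \<epsilon> i j a \<in> gen A"
    and "i \<in> {1..n}" "b \<in> {1..n} \<rightarrow> carrier M" "\<beta> \<in> {1..n} \<rightarrow> {1..n}"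
  shows "\<exists>s \<in> gen A. \<forall>k \<in> {1..n} - {i}. fst s k = b k \<and> snd s k = \<beta> k"
proof -
  define bad where "bad i b \<beta> = {k \<in> {1..n} - {i}. b k \<noteq> \<one> \<or> \<beta> k \<noteq> k}"
    for i and b :: "nat \<Rightarrow> 'a" and \<beta>
  have fin: "finite (bad i b \<beta>)" for i b \<beta>
    by (simp add: bad_def)
  define ok where "ok i b \<beta> \<longleftrightarrow> (\<exists>s \<in> gen A. \<forall>k \<in> {1..n} - {i}. fst s k = b k \<and> snd s k = \<beta> k)"
    for i b \<beta>
  \<comment> \<open>Prefixing \<open>\<epsilon> i k (b k)\<close> routes \<open>k\<close> through
    \<open>i\<close> and already pays its weight. The rest must then do at \<open>i\<close>, with
    weight \<open>\<one>\<close>, what \<open>\<beta>\<close> does at \<open>k\<close>, and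
    \<open>k\<close> becomes the hole.\<close>
  have slide: "ok i b \<beta>"
    if "i \<in> {1..n}" "k \<in> {1..n}" "i \<noteq> k" "b \<in> {1..n} \<rightarrow> carrier M"
      and ok: "ok k (b(i := \<one>)) (\<beta>(i := \<beta> k))" for i k b \<beta>
  proof -
    obtain s where s: "s \<in> gen A"
      "\<forall>m \<in> {1..n} - {k}. fst s m = (b(i := \<one>)) m \<and> snd s m = (\<beta>(i := \<beta> k)) m"
      using ok ok_def by auto
    have b: "b m \<in> carrier M" if "m \<in> {1..n}" for m
      using \<open>b \<in> _\<close> that by auto
    have "\<epsilon> i k (b k) \<star> s \<in> gen A"
      using S b that s by (intro semigroup_generated.mult) auto
    then show ?thesis
      unfolding ok_def by (rule bexI[rotated]) (use b that s in \<open>auto simp del: atLeastAtMost_iff\<close>)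
  qed
  \<comment> \<open>A point \<open>k\<close> sent into the hole is bad. After the slide it is the
    hole itself, while \<open>i\<close> is fixed with weight \<open>\<one>\<close>, so no new bad
    point arises.\<close>
  have hit: "card (bad k (b(i := \<one>)) (\<beta>(i := \<beta> k))) < card (bad i b \<beta>)"
    if "i \<in> {1..n}" "k \<in> {1..n}" "i \<noteq> k" "\<beta> k = i" for i k b \<beta>
  proof (rule psubset_card_mono[OF fin])
    have "k \<in> bad i b \<beta>" "k \<notin> bad k (b(i := \<one>)) (\<beta>(i := \<beta> k))"
      using that by (auto simp: bad_def)
    moreover have "bad k (b(i := \<one>)) (\<beta>(i := \<beta> k)) \<subseteq> bad i b \<beta>"
      using that by (auto simp: bad_def)
    ultimately show "bad k (b(i := \<one>)) (\<beta>(i := \<beta> k)) \<subset> bad i b \<beta>" by blast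
  qed
  have "ok i b \<beta>"
    using assms(2-)
  proof (induction "card (bad i b \<beta>)" arbitrary: i b \<beta> rule: less_induct)
    case less
    have bc: "b k \<in> carrier M" "\<beta> k \<in> {1..n}" if "k \<in> {1..n}" for k
      using less.prems that by auto
    have upd: "b(p := \<one>) \<in> {1..n} \<rightarrow> carrier M" "q \<in> {1..n} \<Longrightarrow> \<beta>(p := q) \<in> {1..n} \<rightarrow> {1..n}" for p q
      using less.prems by auto
    have step: "ok i' b' \<beta>'" if "card (bad i' b' \<beta>') < card (bad i b \<beta>)" "i' \<in> {1..n}"
      "b' \<in> {1..n} \<rightarrow> carrier M" "\<beta>' \<in> {1..n} \<rightarrow> {1..n}" for i' b' \<beta>'
      using less.hyps that by blast
    show ?case
    proof (cases "bad i b \<beta> = {}")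
      case True
      obtain j where "j \<in> {1..n}" "j \<noteq> i"
        using n_ge_2 that[of 1] that[of 2] by fastforce
      then have "\<epsilon> j i \<one> \<in> gen A"
        using S less.prems by blast
      then show ?thesis
        unfolding ok_def by (rule bexI[rotated]) (use True bad_def in auto)
    next
      case False
      then obtain k where k: "k \<in> bad i b \<beta>" by blast
      then have k': "k \<in> {1..n}" "k \<noteq> i"
        by (auto simp: bad_def)
      define l where "l = \<beta> k"
      have l: "l \<in> {1..n}"
        using k' bc l_def by auto
      consider "l = i" | "l \<noteq> i" "l \<notin> bad i b \<beta>" | "l \<in> bad i b \<beta>"
        by blast
      then show ?thesis
      proof cases
        case 1
        then have "\<beta> k = i"
          using l_def by simp
        from hit[of i k \<beta> b, OF less.prems(1) k'(1) k'(2)[symmetric] this] show ?thesis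
          using less.prems k' bc upd
          by (intro slide[of i k b \<beta>, OF less.prems(1) k'(1) k'(2)[symmetric] less.prems(2)] step) auto
      next
        case 2
        then have good: "b l = \<one>" "\<beta> l = l" "l \<noteq> k"
          using k l by (auto simp: bad_def)
        \<comment> \<open>Since \<open>l\<close> is fixed with weight \<open>\<one>\<close>, merging
          \<open>k\<close> into \<open>l\<close> first settles \<open>k\<close>. The image of
          \<open>\<epsilon> l k (b k)\<close> misses \<open>k\<close>, so the rest may treat
          \<open>k\<close> as good.\<close>
        have "bad i (b(k := \<one>)) (\<beta>(k := k)) \<subset> bad i b \<beta>"
          using k by (auto simp: bad_def)
        then have "ok i (b(k := \<one>)) (\<beta>(k := k))"
          using less.prems k' upd by (intro step psubset_card_mono fin) auto
        then obtain s where s: "s \<in> gen A"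
          "\<forall>m \<in> {1..n} - {i}. fst s m = (b(k := \<one>)) m \<and> snd s m = (\<beta>(k := k)) m"
          using ok_def by auto
        have "\<epsilon> l k (b k) \<star> s \<in> gen A"
          using S l k' bc good s by (intro semigroup_generated.mult) auto
        then show ?thesis
          unfolding ok_def
          by (rule bexI[rotated])
            (use s good bc k' l 2 l_def in \<open>auto simp del: atLeastAtMost_iff\<close>)
      next
        case 3
        \<comment> \<open>Slide the hole to \<open>l\<close>: the count does not grow, because
          \<open>l\<close> stops being bad and at most \<open>i\<close> joins. A second slide, along
          a point sent to \<open>l\<close>, then lowers it.\<close>
        then have li: "l \<noteq> i"
          by (auto simp: bad_def)
        let ?b = "b(i := \<one>)" and ?\<beta> = "\<beta>(i := \<beta> l)"
        have upd': "?b \<in> {1..n} \<rightarrow> carrier M" "?\<beta> \<in> {1..n} \<rightarrow> {1..n}"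
          using upd bc l by auto
        have "bad l ?b ?\<beta> \<subseteq> insert i (bad i b \<beta> - {l})"
          by (auto simp: bad_def)
        then have "card (bad l ?b ?\<beta>) \<le> card (insert i (bad i b \<beta> - {l}))"
          by (intro card_mono) (auto simp: fin)
        also have "\<dots> \<le> card (bad i b \<beta>)"
          using card_Suc_Diff1[OF fin 3] fin[of i b \<beta>] by (simp add: card_insert_if)
        finally have le: "card (bad l ?b ?\<beta>) \<le> card (bad i b \<beta>)" .
        \<comment> \<open>A point now sent to the hole \<open>l\<close>: either \<open>k\<close>,
          or, if \<open>\<beta> k = k\<close>, the old hole \<open>i\<close>, which has inherited
          the target of \<open>l\<close>.\<close>
        define m where "m = (if l = k then i else k)"
        have m: "m \<in> {1..n}" "l \<noteq> m" "?\<beta> m = l"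
          using k' less.prems li l_def by (auto simp: m_def)
        have "?b(l := \<one>) \<in> {1..n} \<rightarrow> carrier M" "?\<beta>(l := ?\<beta> m) \<in> {1..n} \<rightarrow> {1..n}"
          using upd' l m(3) by (auto simp: Pi_iff simp del: atLeastAtMost_iff)
        from step[OF _ m(1) this] have "ok l ?b ?\<beta>"
          using hit[of l m ?\<beta> ?b, OF l m] le by (intro slide[of l m ?b ?\<beta>, OF l m(1,2) upd'(1)]) linarith
        then show ?thesis
          using l li bc less.prems by (intro slide[of i l b \<beta>]) auto
      qed
    qed
  qed
  then show ?thesis
    by (simp add: ok_def)
qed

lemma L_chain_comparable:
  assumes "L_chain M" "a \<in> carrier M" "b \<in> carrier M"
  shows "L_le M a b \<or> L_le M b a"
proof -
  have "L_rel M `` {a} \<in> L_classes M" "L_rel M `` {b} \<in> L_classes M"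
    using assms by (auto simp: L_classes_def intro: quotientI)
  moreover have "refl_on (L_classes M) (L_order M)" "total_on (L_classes M) (L_order M)"
    using assms(1) by (auto simp: L_chain_def linear_order_on_def partial_order_on_def preorder_on_def)
  ultimately show ?thesis
    using assms L_order_iff by (metis refl_onD total_on_def)
qed

text \<open>The chain hypothesis acts here: of two points with the same image, one has a weight that
  is a left multiple of the other's.\<close>

lemma generates_if_\<epsilon>:
  assumes chain: "L_chain M" and A: "A \<subseteq> W"
    and S: "\<And>i j a. i \<in> {1..n} \<Longrightarrow> j \<in> {1..n} \<Longrightarrow> i \<noteq> j \<Longrightarrow> a \<in> carrier M \<Longrightarrow> \<epsilon> i j a \<in> gen A"
  shows "generates_semigroup W (wreath_mult M n) A"
proof -
  have "w \<in> gen A" if w: "w \<in> W" for w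
  proof -
    obtain p q where pq: "p \<in> {1..n}" "q \<in> {1..n}" "p \<noteq> q" "snd w p = snd w q"
      using w unfolding mem_W_iff by blast
    have factor: "w \<in> gen A"
      if ij: "i \<in> {1..n}" "j \<in> {1..n}" "i \<noteq> j" "snd w i = snd w j" "L_le M (fst w i) (fst w j)" for i j
    proof -
      obtain x where x: "x \<in> carrier M" "fst w i = x \<otimes> fst w j"
        using ij by (auto simp: L_le_def)
      have "fst w \<in> {1..n} \<rightarrow> carrier M" "snd w \<in> {1..n} \<rightarrow> {1..n}"
        using w by (auto simp only: mem_W_iff PiE_iff)
      then obtain s where s: "s \<in> gen A" "\<forall>k \<in> {1..n} - {i}. fst s k = fst w k \<and> snd s k = snd w k"
        using agree_off_hole[OF S ij(1)] by blast
      have e: "\<epsilon> j i x \<in> gen A"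
        using S ij x by auto
      have "\<epsilon> j i x \<star> s = w"
      proof (rule W_eqI)
        show "\<epsilon> j i x \<star> s \<in> W"
          using gen_subset_W[OF A] e s by (auto intro: mult_closed)
      qed (use w s x ij in \<open>auto simp del: atLeastAtMost_iff\<close>)
      then show ?thesis
        using semigroup_generated.mult[OF e s(1)] by metis
    qed
    show ?thesis
      using factor[of p q] factor[of q p] pq w L_chain_comparable[OF chain, of "fst w p" "fst w q"]
      by auto
  qed
  then show ?thesis
    using A gen_subset_W[OF A] by (auto simp only: generates_semigroup_def)
qed

text \<open>The first factor has the right kernel, with weights \<open>\<one>\<close> at
  \<open>i\<close> and \<open>g\<close> at \<open>j\<close>. The others carry the common image to
  \<open>j\<close> and multiply both weights by \<open>inv g\<close>.\<close>

lemma \<epsilon>_reverse_unit: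
  assumes "i \<in> {1..n}" "j \<in> {1..n}" "i \<noteq> j" "g \<in> Units M"
    and "\<epsilon> i j g \<in> gen A" "\<epsilon> i j (inv g) \<in> gen A" "\<epsilon> j i \<one> \<in> gen A"
  shows "\<epsilon> j i (inv g) \<in> gen A"
proof -
  have "\<epsilon> i j g \<star> \<epsilon> j i \<one> \<star> \<epsilon> i j (inv g) \<star> \<epsilon> j i \<one> = \<epsilon> j i (inv g)"
    by (rule W_eqI) (use assms in
        \<open>auto simp: mult_closed \<epsilon>_in_W Units_closed simp del: atLeastAtMost_iff\<close>)
  then show ?thesis
    using assms by (metis semigroup_generated.mult)
qed

text \<open>After the first factor the common image travels from \<open>i\<close> to
  \<open>j\<close>, back and again to \<open>j\<close>, with weights \<open>g\<close>,
  \<open>\<one>\<close> and \<open>inv g\<close>, which cancel.\<close>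

lemma \<epsilon>_reverse_one:
  assumes "i \<in> {1..n}" "j \<in> {1..n}" "i \<noteq> j" "g \<in> Units M"
    and "\<epsilon> i j \<one> \<in> gen A" "\<epsilon> j i g \<in> gen A" "\<epsilon> j i (inv g) \<in> gen A"
  shows "\<epsilon> j i \<one> \<in> gen A"
proof -
  have "\<epsilon> i j \<one> \<star> \<epsilon> j i g \<star> \<epsilon> i j \<one> \<star> \<epsilon> j i (inv g) = \<epsilon> j i \<one>"
    by (rule W_eqI) (use assms in
        \<open>auto simp: mult_closed \<epsilon>_in_W Units_closed simp del: atLeastAtMost_iff\<close>)
  then show ?thesis
    using assms by (metis semigroup_generated.mult)
qed

text \<open>One turn \<open>?r\<close> around the cycle sends \<open>i\<close> and \<open>j\<close>
  to \<open>p\<close>, and \<open>p\<close> to \<open>j\<close>; a second turn brings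
  \<open>i\<close> and \<open>j\<close> to \<open>j\<close>, and \<open>p\<close> home.\<close>

lemma \<epsilon>_reverse_cycle:
  assumes "i \<in> {1..n}" "j \<in> {1..n}" "p \<in> {1..n}" "i \<noteq> j" "j \<noteq> p" "p \<noteq> i"
    and "\<epsilon> i j \<one> \<in> gen A" "\<epsilon> j p \<one> \<in> gen A" "\<epsilon> p i \<one> \<in> gen A"
  shows "\<epsilon> j i \<one> \<in> gen A"
proof -
  let ?r = "\<epsilon> i j \<one> \<star> \<epsilon> j p \<one> \<star> \<epsilon> p i \<one>"
  have "?r \<star> ?r = \<epsilon> j i \<one>"
    by (rule W_eqI) (use assms in \<open>auto simp: mult_closed \<epsilon>_in_W simp del: atLeastAtMost_iff\<close>)
  then show ?thesis
    using assms by (metis semigroup_generated.mult)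
qed


section \<open>Lower bounds\<close>

text \<open>The functions \<open>c\<close> and \<open>\<gamma>\<close> stand for the remaining
  factors. They need not form an element of \<open>W\<close>: for a single factor they are the
  identity, which is not singular.\<close>

lemma first_factor:
  assumes "x \<in> gen A" "A \<subseteq> W"
  shows "\<exists>g\<in>A. \<exists>c \<gamma>. c \<in> {1..n} \<rightarrow> carrier M \<and> \<gamma> \<in> {1..n} \<rightarrow> {1..n} \<and>
    (\<forall>k\<in>{1..n}. fst x k = fst g k \<otimes> c (snd g k) \<and> snd x k = \<gamma> (snd g k))"
  using assms(1)
proof induction
  case (incl x)
  then show ?case
    using assms(2) by (intro bexI[of _ x] exI[of _ "\<lambda>_. \<one>"] exI[of _ "\<lambda>k. k"]) auto
next
  case (mult x y)
  then obtain g c \<gamma> where g: "g \<in> A" "c \<in> {1..n} \<rightarrow> carrier M" "\<gamma> \<in> {1..n} \<rightarrow> {1..n}"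
    "\<forall>k\<in>{1..n}. fst x k = fst g k \<otimes> c (snd g k) \<and> snd x k = \<gamma> (snd g k)"
    by blast
  have y: "y \<in> W" and gW: "g \<in> W"
    using mult.hyps g assms(2) gen_subset_W[OF assms(2)] by auto
  show ?case
  proof (intro bexI[OF _ g(1)] exI[of _ "\<lambda>k. c k \<otimes> fst y (\<gamma> k)"] exI[of _ "\<lambda>k. snd y (\<gamma> k)"]
      conjI ballI)
    fix k assume k: "k \<in> {1..n}"
    have "c (snd g k) \<in> carrier M" "\<gamma> (snd g k) \<in> {1..n}"
      using g W_map[OF gW k] by auto
    then show "fst (x \<star> y) k = fst g k \<otimes> (c (snd g k) \<otimes> fst y (\<gamma> (snd g k)))"
      using g k y gW by (simp add: m_assoc W_weight del: atLeastAtMost_iff)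
    show "snd (x \<star> y) k = snd y (\<gamma> (snd g k))"
      using g k by (simp del: atLeastAtMost_iff)
  qed (use g y in \<open>auto simp only: Pi_iff intro!: m_closed W_weight W_map\<close>)
qed

text \<open>The kernel of \<open>g\<close> lies in that of \<open>\<epsilon> i j a\<close> and is
  not trivial, as \<open>g\<close> is singular. So \<open>g\<close> merges \<open>i\<close> and
  \<open>j\<close>, and both weights get the same right factor \<open>d\<close>, the inverse of
  \<open>fst g i\<close>.\<close>

lemma first_factor_\<epsilon>:
  assumes "\<epsilon> i j a \<in> gen A" "A \<subseteq> W" "i \<in> {1..n}" "j \<in> {1..n}" "i \<noteq> j"
  shows "\<exists>g\<in>A. fst g i \<in> Units M \<and> a = fst g j \<otimes> inv (fst g i) \<and>
    (\<forall>k\<in>{1..n}. \<forall>l\<in>{1..n}. k \<noteq> l \<longrightarrow> snd g k = snd g l \<longleftrightarrow> {k, l} = {i, j})"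
proof -
  obtain g c \<gamma> where g: "g \<in> A" "c \<in> {1..n} \<rightarrow> carrier M"
    "\<forall>k\<in>{1..n}. fst (\<epsilon> i j a) k = fst g k \<otimes> c (snd g k) \<and> snd (\<epsilon> i j a) k = \<gamma> (snd g k)"
    using first_factor[OF assms(1,2)] by blast
  have gW: "g \<in> W"
    using g assms by auto
  have only: "{k, l} = {i, j}" if "k \<in> {1..n}" "l \<in> {1..n}" "k \<noteq> l" "snd g k = snd g l" for k l
  proof -
    have "snd (\<epsilon> i j a) k = snd (\<epsilon> i j a) l"
      using g that by metis
    then show ?thesis
      using that by (auto split: if_splits)
  qed
  obtain k l where "k \<in> {1..n}" "l \<in> {1..n}" "k \<noteq> l" "snd g k = snd g l"
    using gW unfolding mem_W_iff by blast
  then have ij: "snd g i = snd g j"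
    using only[of k l] by (metis doubleton_eq_iff)
  define d where "d = c (snd g i)"
  have d: "d \<in> carrier M"
    using g(2) W_map[OF gW assms(3)] d_def by auto
  have i: "fst g i \<otimes> d = \<one>" and j: "fst g j \<otimes> d = a"
    using g(3) assms(3-) ij d_def by (force simp del: atLeastAtMost_iff)+
  have u: "fst g i \<in> Units M"
    using finite_right_inverse_Units[OF finite_carrier _ d i] gW assms by blast
  then have "d = inv (fst g i)"
    using i d Units_l_inv Units_inv_closed Units_closed inv_unique by metis
  moreover have "snd g k = snd g l \<longleftrightarrow> {k, l} = {i, j}" if "k \<in> {1..n}" "l \<in> {1..n}" "k \<noteq> l" for k l
    using only[OF that] ij by (metis doubleton_eq_iff)
  ultimately show ?thesis
    using g(1) u j by blast
qed

text \<open>With \<open>X = carrier M\<close> these index the \<open>\<epsilon> i j a\<close> for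
  \<open>i < j\<close>; with the nonunits as \<open>X\<close>, the reversed
  \<open>\<epsilon> j i a\<close>, leaving out those that may share a first factor with the
  former.\<close>

definition triples :: "'a set \<Rightarrow> (nat \<times> nat \<times> 'a) set" where
  "triples X = {(i, j, a). 1 \<le> i \<and> i < j \<and> j \<le> n \<and> a \<in> X}"

lemma finite_triples [simp]: "X \<subseteq> carrier M \<Longrightarrow> finite (triples X)"
  and card_triples: "X \<subseteq> carrier M \<Longrightarrow> card (triples X) = card X * (n choose 2)"
proof -
  let ?P = "{(i, j). 1 \<le> i \<and> i < j \<and> j \<le> n}"
  have eq: "triples X = (\<lambda>((i, j), a). (i, j, a)) ` (?P \<times> X)"
    by (force simp: triples_def)
  have inj: "inj_on (\<lambda>((i, j), a). (i, j, a)) (?P \<times> X)"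
    by (auto simp: inj_on_def)
  have "finite ?P"
    by (rule finite_subset[of _ "{1..n} \<times> {1..n}"]) auto
  then show "finite (triples X)" if "X \<subseteq> carrier M"
    using that finite_subset[OF that finite_carrier] by (simp add: eq)
  show "card (triples X) = card X * (n choose 2)" if "X \<subseteq> carrier M"
    unfolding eq card_image[OF inj] card_cartesian_product card_increasing_pairs by simp
qed

lemma triples_count:
  "card (triples (carrier M)) + card (triples (carrier M - Units M)) =
    (2 * card (carrier M) - card (Units M)) * (n choose 2)"
proof -
  have U: "Units M \<subseteq> carrier M"
    by auto
  have "card (carrier M - Units M) = card (carrier M) - card (Units M)"
    using U finite_carrier by (meson card_Diff_subset finite_subset)
  moreover have "card (Units M) \<le> card (carrier M)"
    by (simp add: U card_mono finite_carrier)
  ultimately show ?thesis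
    by (simp add: card_triples add_mult_distrib[symmetric] mult_2)
qed

lemma card_generates_ge:
  assumes "finite A" "generates_semigroup W (wreath_mult M n) A"
  shows "(2 * card (carrier M) - card (Units M)) * (n choose 2) \<le> card A"
proof -
  have A: "A \<subseteq> W" and genA: "gen A = W"
    using assms by (auto simp: generates_semigroup_def)
  define ker where "ker g i j \<longleftrightarrow>
    (\<forall>k\<in>{1..n}. \<forall>l\<in>{1..n}. k \<noteq> l \<longrightarrow> snd g k = snd g l \<longleftrightarrow> {k, l} = {i, j})"
    for g :: "(nat \<Rightarrow> 'a) \<times> (nat \<Rightarrow> nat)" and i j
  have ker_unique: "i = i' \<and> j = j'"
    if "ker g i j" "ker g i' j'" "1 \<le> i" "i < j" "j \<le> n" "1 \<le> i'" "i' < j'" "j' \<le> n" for g i j i' j'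
  proof -
    have mem: "i \<in> {1..n}" "j \<in> {1..n}" "i \<noteq> j"
      using that by auto
    then have "snd g i = snd g j"
      using that(1) by (simp add: ker_def del: atLeastAtMost_iff)
    then have "{i, j} = {i', j'}"
      using that(2) mem by (simp add: ker_def del: atLeastAtMost_iff)
    then show ?thesis
      using that by (auto simp: doubleton_eq_iff)
  qed
  \<comment> \<open>\<open>P\<close> says that \<open>g\<close> qualifies as first factor for
    \<open>\<epsilon> i j a\<close>, and \<open>Q\<close> the same for
    \<open>\<epsilon> j i a\<close>. Since \<open>i < j\<close>, the kernel of \<open>g\<close>
    gives back \<open>i\<close> and \<open>j\<close>, and its weights give \<open>a\<close>.\<close>
  define P where "P = (\<lambda>(i, j, a) g. g \<in> A \<and> fst g i \<in> Units M \<and> a = fst g j \<otimes> inv (fst g i) \<and> ker g i j)"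
  define Q where "Q = (\<lambda>(i, j, a) g. g \<in> A \<and> fst g j \<in> Units M \<and> a = fst g i \<otimes> inv (fst g j) \<and> ker g i j)"
  have exP: "\<exists>g. P t g" if "t \<in> triples (carrier M)" for t
  proof -
    obtain i j a where t: "t = (i, j, a)" by (cases t)
    then have mem: "i \<in> {1..n}" "j \<in> {1..n}" "i \<noteq> j" "a \<in> carrier M"
      using that by (auto simp: triples_def)
    then have "\<epsilon> i j a \<in> gen A"
      using genA \<epsilon>_in_W by simp
    from first_factor_\<epsilon>[OF this A mem(1-3)] obtain g where "P t g"
      unfolding t P_def ker_def prod.case by blast
    then show ?thesis by blast
  qed
  have exQ: "\<exists>g. Q t g" if "t \<in> triples (carrier M - Units M)" for t
  proof -
    obtain i j a where t: "t = (i, j, a)" by (cases t)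
    then have mem: "j \<in> {1..n}" "i \<in> {1..n}" "j \<noteq> i" "a \<in> carrier M"
      using that by (auto simp: triples_def)
    then have "\<epsilon> j i a \<in> gen A"
      using genA \<epsilon>_in_W by simp
    from first_factor_\<epsilon>[OF this A mem(1-3)] obtain g where "Q t g"
      unfolding t Q_def ker_def prod.case insert_commute[of i j] by blast
    then show ?thesis by blast
  qed
  define p where "p t = (SOME g. P t g)" for t
  define q where "q t = (SOME g. Q t g)" for t
  have p: "P t (p t)" if "t \<in> triples (carrier M)" for t
    using exP[OF that] someI_ex p_def by metis
  have q: "Q t (q t)" if "t \<in> triples (carrier M - Units M)" for t
    using exQ[OF that] someI_ex q_def by metis
  have P_unique: "t = t'" if "P t g" "P t' g" "t \<in> triples (carrier M)" "t' \<in> triples (carrier M)" for t t' g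
  proof -
    obtain i j a i' j' a' where t: "t = (i, j, a)" "t' = (i', j', a')"
      by (cases t, cases t') auto
    then have "i = i' \<and> j = j'"
      using that by (intro ker_unique[of g]) (auto simp: P_def triples_def)
    then show ?thesis
      using that t by (auto simp: P_def)
  qed
  have Q_unique: "t = t'" if "Q t g" "Q t' g" "t \<in> triples (carrier M - Units M)"
    "t' \<in> triples (carrier M - Units M)" for t t' g
  proof -
    obtain i j a i' j' a' where t: "t = (i, j, a)" "t' = (i', j', a')"
      by (cases t, cases t') auto
    then have "i = i' \<and> j = j'"
      using that by (intro ker_unique[of g]) (auto simp: Q_def triples_def)
    then show ?thesis
      using that t by (auto simp: Q_def)
  qed
  \<comment> \<open>A common \<open>g\<close> would have unit weights at both points, making the
    nonunit \<open>a'\<close> a unit.\<close>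
  have PQ: False if "P t g" "Q t' g" "t \<in> triples (carrier M)" "t' \<in> triples (carrier M - Units M)" for t t' g
  proof -
    obtain i j a i' j' a' where t: "t = (i, j, a)" "t' = (i', j', a')"
      by (cases t, cases t') auto
    then have "i = i' \<and> j = j'"
      using that by (intro ker_unique[of g]) (auto simp: P_def Q_def triples_def)
    then have "a' \<in> Units M"
      using that t by (auto simp: P_def Q_def)
    then show False
      using that t by (auto simp: triples_def)
  qed
  have "inj_on p (triples (carrier M))"
    using p P_unique by (intro inj_onI) metis
  moreover have "inj_on q (triples (carrier M - Units M))"
    using q Q_unique by (intro inj_onI) metis
  moreover have "p ` triples (carrier M) \<inter> q ` triples (carrier M - Units M) = {}"
    using p q PQ by (auto simp: set_eq_iff) metis
  ultimately have "card (triples (carrier M)) + card (triples (carrier M - Units M)) =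
      card (p ` triples (carrier M) \<union> q ` triples (carrier M - Units M))"
    by (subst card_Un_disjoint) (auto simp: card_image)
  also have "\<dots> \<le> card A"
    using p q by (intro card_mono assms(1)) (fastforce simp: P_def Q_def)
  finally show ?thesis
    by (simp add: triples_count)
qed

lemma \<epsilon>_inj:
  assumes "\<epsilon> i j a = \<epsilon> i' j' a'" "i \<in> {1..n}" "j \<in> {1..n}" "i \<noteq> j" "i' \<in> {1..n}" "j' \<in> {1..n}" "i' \<noteq> j'"
  shows "i = i' \<and> j = j' \<and> a = a'"
proof -
  have "snd (\<epsilon> i j a) j = snd (\<epsilon> i' j' a') j" "fst (\<epsilon> i j a) j = fst (\<epsilon> i' j' a') j"
    using assms(1) by simp_all
  then show ?thesis
    using assms(2-) by (auto simp del: atLeastAtMost_iff split: if_splits)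
qed

text \<open>Every \<open>\<epsilon> i j a\<close> must itself lie in \<open>A\<close>: the singular
  maps on two points are constant, and idempotency ties the weights to the image.\<close>

lemma card_idempotent_generates_ge:
  assumes "finite A" "generates_semigroup W (wreath_mult M n) A"
    and idem: "A \<subseteq> semigroup_idempotents W (wreath_mult M n)"
    and n: "n = 2" and unit: "card (Units M) = 1"
  shows "2 * card (carrier M) \<le> card A"
proof -
  have A: "A \<subseteq> W" and genA: "gen A = W"
    using assms by (auto simp: generates_semigroup_def)
  have U: "Units M = {\<one>}"
    using unit Units_one_closed by (metis card_1_singletonE singletonD)
  have two: "k = i \<or> k = j" if "i \<in> {1..n}" "j \<in> {1..n}" "i \<noteq> j" "k \<in> {1..n}" for i j k
    using that n by auto
  have const: "snd x i = snd x j" if "x \<in> W" "i \<in> {1..n}" "j \<in> {1..n}" "i \<noteq> j" for x i j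
    using that two unfolding mem_W_iff by metis
  have gen_mem: "\<epsilon> i j a \<in> A" if ij: "i \<in> {1..n}" "j \<in> {1..n}" "i \<noteq> j" and a: "a \<in> carrier M" for i j a
  proof -
    have eqI: "x = \<epsilon> i j c" if "x \<in> W" "snd x i = i" "fst x i = \<one>" "fst x j = c" for x c
    proof (rule W_eqI)
      show "\<epsilon> i j c \<in> W"
        using ij that by (intro \<epsilon>_in_W) auto
      fix k assume k: "k \<in> {1..n}"
      show "fst x k = fst (\<epsilon> i j c) k" "snd x k = snd (\<epsilon> i j c) k"
        using two[OF ij k] k ij that const[OF that(1) ij] by auto
    qed (rule that(1))
    have idem_eq: "fst x k \<otimes> fst x (snd x k) = fst x k" if "x \<in> A" "k \<in> {1..n}" for x k
    proof -
      have "x \<star> x = x"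
        using idem that(1) by (auto simp only: semigroup_idempotents_iff)
      then show ?thesis
        using fst_mult[OF that(2), of x x] by simp
    qed
    show ?thesis
    proof (cases "a = \<one>")
      case False
      have "\<epsilon> i j a \<in> gen A"
        using genA ij a \<epsilon>_in_W by simp
      then obtain g where g: "g \<in> A" "fst g i \<in> Units M" "a = fst g j \<otimes> inv (fst g i)"
        using first_factor_\<epsilon>[OF _ A ij] by blast
      then have gW: "g \<in> W" and w: "fst g i = \<one>" "fst g j = a"
        using U A ij by (auto simp del: atLeastAtMost_iff)
      \<comment> \<open>With image \<open>j\<close>, idempotency at \<open>i\<close> would give
        \<open>\<one> \<otimes> a = \<one>\<close>.\<close>
      have "snd g i \<noteq> j"
        using idem_eq[OF g(1) ij(1)] w False a by auto
      then have "snd g i = i"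
        using two[OF ij W_map[OF gW ij(1)]] by simp
      then show ?thesis
        using eqI[OF gW _ w] g(1) by simp
    next
      case True
      \<comment> \<open>\<open>T\<close> is a subsemigroup missing
        \<open>\<epsilon> i j \<one>\<close>, so some generator lies outside it. Idempotency at
        \<open>j\<close> then forces that generator to have weight \<open>\<one>\<close> at
        \<open>i\<close> too.\<close>
      define T where "T = {x \<in> W. snd x i = i \<longrightarrow> fst x j \<noteq> \<one>}"
      have "x \<star> y \<in> T" if "x \<in> T" "y \<in> T" for x y
      proof -
        have xy: "x \<in> W" "y \<in> W"
          using that by (auto simp: T_def)
        have False if *: "snd (x \<star> y) i = i" "fst (x \<star> y) j = \<one>"
        proof -
          define k where "k = snd x j"
          have k: "k \<in> {1..n}" "snd x i = k"
            using W_map[OF xy(1) ij(2)] const[OF xy(1) ij] by (simp_all only: k_def)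
          have "snd y k = i"
            using *(1) snd_mult[OF ij(1), of x y] k(2) by simp
          then have yi: "snd y i = i"
            using two[OF ij k(1)] const[OF xy(2) ij] by auto
          have e: "fst x j \<otimes> fst y k = \<one>"
            using *(2) fst_mult[OF ij(2), of x y] by (simp only: k_def)
          have c: "fst x j \<in> carrier M" "fst y k \<in> carrier M"
            using xy ij k by blast+
          have x1: "fst x j = \<one>"
            using finite_right_inverse_Units[OF finite_carrier c e] U by blast
          then have "fst y k = \<one>"
            using e c by simp
          moreover have "k = j"
            using x1 \<open>x \<in> T\<close> k two[OF ij k(1)] by (auto simp: T_def)
          ultimately show False
            using \<open>y \<in> T\<close> yi by (simp add: T_def)
        qed
        then show ?thesis
          using mult_closed[OF xy] by (auto simp: T_def)
      qed
      moreover have "\<epsilon> i j \<one> \<notin> T" "\<epsilon> i j \<one> \<in> gen A"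
        using genA ij \<epsilon>_in_W by (auto simp: T_def simp del: atLeastAtMost_iff)
      ultimately obtain x where x: "x \<in> A" "x \<notin> T"
        using semigroup_generated_subset[of A T "wreath_mult M n"] by blast
      then have *: "x \<in> W" "snd x i = i" "fst x j = \<one>"
        using A by (auto simp: T_def)
      have "snd x j = i"
        using const[OF *(1) ij] * by simp
      then have "fst x i = \<one>"
        using idem_eq[OF x(1) ij(2)] * ij by (simp add: W_weight del: atLeastAtMost_iff)
      then show ?thesis
        using eqI[of x \<one>] * x True by auto
    qed
  qed
  let ?I = "{(1::nat, 2::nat), (2, 1)} \<times> carrier M"
  have "inj_on (\<lambda>((i, j), a). \<epsilon> i j a) ?I"
  proof (rule inj_onI)
    fix t t' assume t: "t \<in> ?I" "t' \<in> ?I"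
      and eq: "(case t of (ij, a) \<Rightarrow> (case ij of (i, j) \<Rightarrow> \<epsilon> i j) a) = (case t' of (ij, a) \<Rightarrow> (case ij of (i, j) \<Rightarrow> \<epsilon> i j) a)"
    obtain i j a i' j' a' where tt: "t = ((i, j), a)" "t' = ((i', j'), a')"
      by (cases t, cases t') auto
    have "i \<in> {1..n}" "j \<in> {1..n}" "i \<noteq> j" "i' \<in> {1..n}" "j' \<in> {1..n}" "i' \<noteq> j'"
      using t tt n by auto
    then show "t = t'"
      using eq \<epsilon>_inj[of i j a i' j' a'] tt by simp
  qed
  then have "2 * card (carrier M) = card ((\<lambda>((i, j), a). \<epsilon> i j a) ` ?I)"
    by (simp add: card_image card_cartesian_product)
  also have "\<dots> \<le> card A"
    using gen_mem n by (intro card_mono assms(1)) auto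
  finally show ?thesis .
qed


section \<open>Small generating sets\<close>

text \<open>Of \<open>\<epsilon> i j g\<close> and \<open>\<epsilon> j i g\<^sup>-\<^sup>1\<close>, for a unit \<open>g\<close>, exactly one is chosen; \<open>d\<close> prescribes which.\<close>

definition choice_set :: "(nat \<Rightarrow> nat \<Rightarrow> 'a \<Rightarrow> bool) \<Rightarrow> ((nat \<Rightarrow> 'a) \<times> (nat \<Rightarrow> nat)) set" where
  "choice_set d =
    (\<lambda>(i, j, a). if a \<in> Units M \<and> d i j a then \<epsilon> j i a else \<epsilon> i j a) ` triples (carrier M) \<union>
    (\<lambda>(i, j, a). \<epsilon> j i a) ` triples (carrier M - Units M)"

lemma finite_choice_set: "finite (choice_set d)"
  by (simp add: choice_set_def)

lemma card_choice_set: "card (choice_set d) \<le> (2 * card (carrier M) - card (Units M)) * (n choose 2)"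
  unfolding choice_set_def triples_count[symmetric]
  by (rule order.trans[OF card_Un_le]) (intro add_mono card_image_le; simp)

lemma choice_set_idempotent: "choice_set d \<subseteq> semigroup_idempotents W (wreath_mult M n)"
  by (auto simp: choice_set_def triples_def intro!: \<epsilon>_idempotent)

lemma choice_set_mem:
  assumes "1 \<le> i" "i < j" "j \<le> n" "a \<in> carrier M"
  shows "a \<notin> Units M \<Longrightarrow> \<epsilon> i j a \<in> choice_set d" "a \<notin> Units M \<Longrightarrow> \<epsilon> j i a \<in> choice_set d"
    "a \<in> Units M \<Longrightarrow> d i j a \<Longrightarrow> \<epsilon> j i a \<in> choice_set d"
    "a \<in> Units M \<Longrightarrow> \<not> d i j a \<Longrightarrow> \<epsilon> i j a \<in> choice_set d"
proof -
  have "(i, j, a) \<in> triples (carrier M)"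
    using assms by (simp add: triples_def)
  then have 1: "(if a \<in> Units M \<and> d i j a then \<epsilon> j i a else \<epsilon> i j a) \<in> choice_set d"
    unfolding choice_set_def by (intro UnI1 image_eqI[where x = "(i, j, a)"]) auto
  have 2: "\<epsilon> j i a \<in> choice_set d" if "a \<notin> Units M"
    unfolding choice_set_def
    by (intro UnI2 image_eqI[where x = "(i, j, a)"]) (use assms that in \<open>auto simp: triples_def\<close>)
  show "a \<notin> Units M \<Longrightarrow> \<epsilon> i j a \<in> choice_set d" "a \<notin> Units M \<Longrightarrow> \<epsilon> j i a \<in> choice_set d"
    "a \<in> Units M \<Longrightarrow> d i j a \<Longrightarrow> \<epsilon> j i a \<in> choice_set d"
    "a \<in> Units M \<Longrightarrow> \<not> d i j a \<Longrightarrow> \<epsilon> i j a \<in> choice_set d"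
    using 1 2 by auto
qed

text \<open>For nonunits both directions are in the set already, so only units have to be
  checked.\<close>

lemma choice_set_generates:
  assumes "L_chain M"
    and units: "\<And>i j g. 1 \<le> i \<Longrightarrow> i < j \<Longrightarrow> j \<le> n \<Longrightarrow> g \<in> Units M \<Longrightarrow>
      \<epsilon> i j g \<in> gen (choice_set d) \<and> \<epsilon> j i g \<in> gen (choice_set d)"
  shows "generates_semigroup W (wreath_mult M n) (choice_set d)"
proof (rule generates_if_\<epsilon>[OF assms(1)])
  show "choice_set d \<subseteq> W"
    using choice_set_idempotent by (auto simp: semigroup_idempotents_def)
  show "\<epsilon> i j a \<in> gen (choice_set d)"
    if "i \<in> {1..n}" "j \<in> {1..n}" "i \<noteq> j" "a \<in> carrier M" for i j a
    using that units[of i j a] units[of j i a] choice_set_mem(1)[of i j a d] choice_set_mem(2)[of j i a d]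
    by (cases "a \<in> Units M"; cases "i < j") (auto intro: semigroup_generated.incl)
qed

text \<open>For \<open>i < j\<close> the set contains \<open>\<epsilon> i j \<one>\<close> and all
  \<open>\<epsilon> j i h\<close> with \<open>h \<noteq> \<one>\<close> a unit. Such an
  \<open>h\<close> yields \<open>\<epsilon> j i \<one>\<close>, after which every unit can be
  reversed.\<close>

lemma choice_set_generates_nontrivial_units:
  assumes "L_chain M" "card (Units M) \<noteq> 1"
  shows "generates_semigroup W (wreath_mult M n) (choice_set (\<lambda>i j a. a \<noteq> \<one>))"
    (is "generates_semigroup _ _ ?A")
proof (rule choice_set_generates[OF assms(1)])
  fix i j g assume ij: "1 \<le> i" "i < j" "j \<le> n" and g: "g \<in> Units M"
  have ij': "i \<in> {1..n}" "j \<in> {1..n}" "i \<noteq> j" "j \<noteq> i"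
    using ij by auto
  have ij1: "\<epsilon> i j \<one> \<in> gen ?A"
    by (intro semigroup_generated.incl choice_set_mem(4)[OF ij]) auto
  have ji: "\<epsilon> j i h \<in> gen ?A" if "h \<in> Units M" "h \<noteq> \<one>" for h
    by (intro semigroup_generated.incl choice_set_mem(3)[OF ij]) (use that in auto)
  have inv1: "inv h \<noteq> \<one>" if "h \<in> Units M" "h \<noteq> \<one>" for h
    using that Units_inv_inv inv_one by metis
  obtain h where h: "h \<in> Units M" "h \<noteq> \<one>"
  proof -
    have "Units M \<noteq> {\<one>}"
      using assms(2) by auto
    then show ?thesis
      using that Units_one_closed by blast
  qed
  have one: "\<epsilon> j i \<one> \<in> gen ?A"
    by (rule \<epsilon>_reverse_one[OF ij'(1-3) h(1) ij1 ji[OF h]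
          ji[OF Units_inv_Units[OF h(1)] inv1[OF h]]])
  then have all: "\<epsilon> j i h \<in> gen ?A" if "h \<in> Units M" for h
    using one ji that by (cases "h = \<one>") auto
  have "\<epsilon> i j (inv (inv g)) \<in> gen ?A"
    by (rule \<epsilon>_reverse_unit[OF ij'(2,1,4) Units_inv_Units[OF g]]) (use ij1 all g in simp_all)
  then show "\<epsilon> i j g \<in> gen ?A \<and> \<epsilon> j i g \<in> gen ?A"
    using all g by simp
qed

text \<open>Only the pair of \<open>1\<close> and \<open>n\<close> is oriented backwards, so every
  \<open>p\<close> between them lies on a directed 3-cycle through \<open>1\<close>,
  \<open>p\<close>, \<open>n\<close>.\<close>

lemma choice_set_generates_trivial_units:
  assumes "L_chain M" "card (Units M) = 1" "n \<ge> 3"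
  shows "generates_semigroup W (wreath_mult M n) (choice_set (\<lambda>i j a. i = 1 \<and> j = n))"
    (is "generates_semigroup _ _ ?A")
proof (rule choice_set_generates[OF assms(1)])
  fix i j g assume ij: "1 \<le> i" "i < j" "j \<le> n" and g: "g \<in> Units M"
  have g1: "g = \<one>"
    using g assms(2) Units_one_closed by (metis card_1_singletonE singletonD)
  have down: "\<epsilon> n 1 \<one> \<in> gen ?A"
    by (intro semigroup_generated.incl choice_set_mem(3)) (use n_ge_2 in auto)
  have up: "\<epsilon> k l \<one> \<in> gen ?A" if "1 \<le> k" "k < l" "l \<le> n" "\<not> (k = 1 \<and> l = n)" for k l
    by (intro semigroup_generated.incl choice_set_mem(4)) (use that in auto)
  have outer: "\<epsilon> p 1 \<one> \<in> gen ?A \<and> \<epsilon> n p \<one> \<in> gen ?A \<and> \<epsilon> 1 n \<one> \<in> gen ?A" if "1 < p" "p < n" for p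
  proof -
    have r: "1 \<in> {1..n}" "p \<in> {1..n}" "n \<in> {1..n}" "1 \<noteq> p" "p \<noteq> n" "n \<noteq> 1"
      using that by auto
    have e: "\<epsilon> 1 p \<one> \<in> gen ?A" "\<epsilon> p n \<one> \<in> gen ?A" "\<epsilon> n 1 \<one> \<in> gen ?A"
      using up[of 1 p] up[of p n] down that by auto
    show ?thesis
      using \<epsilon>_reverse_cycle[OF r(1-6) e(1-3)] \<epsilon>_reverse_cycle[OF r(2,3,1,5,6,4) e(2,3,1)]
        \<epsilon>_reverse_cycle[OF r(3,1,2,6,4,5) e(3,1,2)] by simp
  qed
  have "\<epsilon> i j \<one> \<in> gen ?A"
    using outer[of 2] up[of i j] ij assms(3) by (cases "i = 1 \<and> j = n") auto
  moreover have "\<epsilon> j i \<one> \<in> gen ?A"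
  proof -
    consider "i = 1" "j = n" | "i = 1" "j < n" | "1 < i" "j = n" | "1 < i" "j < n"
      using ij by linarith
    then show ?thesis
    proof cases
      \<comment> \<open>The cycle \<open>i\<close>, \<open>j\<close>, \<open>n\<close> closes
        because \<open>outer\<close> has already provided
        \<open>\<epsilon> n i \<one>\<close>.\<close>
      case 4
      show ?thesis
        by (rule \<epsilon>_reverse_cycle[where p = n and i = i and j = j])
          (use 4 up[of i j] up[of j n] outer[of i] ij in auto)
    qed (use down outer[of i] outer[of j] ij in auto)
  qed
  ultimately show "\<epsilon> i j g \<in> gen ?A \<and> \<epsilon> j i g \<in> gen ?A"
    using g1 by simp
qed

lemma all_\<epsilon>_generates:
  assumes "L_chain M" "n = 2"
  shows "\<exists>A. finite A \<and> A \<subseteq> semigroup_idempotents W (wreath_mult M n) \<and>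
    generates_semigroup W (wreath_mult M n) A \<and> card A \<le> 2 * card (carrier M)"
proof -
  define A where "A = \<epsilon> 1 2 ` carrier M \<union> \<epsilon> 2 1 ` carrier M"
  have idem: "A \<subseteq> semigroup_idempotents W (wreath_mult M n)"
  proof -
    have "(1::nat) \<in> {1..n}" "(2::nat) \<in> {1..n}" "(1::nat) \<noteq> 2" "(2::nat) \<noteq> 1"
      using assms by auto
    then show ?thesis
      unfolding A_def by (intro Un_least image_subsetI \<epsilon>_idempotent)
  qed
  have "generates_semigroup W (wreath_mult M n) A"
  proof (rule generates_if_\<epsilon>[OF assms(1)])
    show "A \<subseteq> W"
      using idem by (auto simp: semigroup_idempotents_def)
    fix i j a assume ij: "i \<in> {1..n}" "j \<in> {1..n}" "i \<noteq> j" and a: "a \<in> carrier M"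
    then have "i = 1 \<and> j = 2 \<or> i = 2 \<and> j = 1"
      using assms by auto
    then show "\<epsilon> i j a \<in> gen A"
      using a by (auto simp: A_def intro: semigroup_generated.incl)
  qed
  moreover have "card A \<le> 2 * card (carrier M)"
    unfolding A_def mult_2
    by (rule order.trans[OF card_Un_le]) (intro add_mono card_image_le finite_carrier)
  ultimately show ?thesis
    using idem finite_carrier by (intro exI[of _ A]) (auto simp: A_def)
qed

text \<open>For \<open>n = 2\<close> and trivial units no set of idempotents attains the lower bound. Instead, each
  \<open>\<epsilon> i j a\<close> with \<open>a \<noteq> 1\<close> is replaced by the element with the same weights and image \<open>{j}\<close>,
  which makes it possible to pass between the two images.\<close>

lemma nonidempotent_generates:
  assumes "L_chain M" "n = 2" "card (Units M) = 1" "card (carrier M) \<noteq> 1"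
  shows "\<exists>A. finite A \<and> generates_semigroup W (wreath_mult M n) A \<and>
    card A \<le> 2 * card (carrier M) - 1"
proof -
  have U: "Units M = {\<one>}"
    using assms(3) Units_one_closed by (metis card_1_singletonE singletonD)
  define \<phi> where "\<phi> i j a = (\<lambda>k\<in>{1..n}. if k = j then a else \<one>, \<lambda>k\<in>{1..n}. j)" for i j :: nat and a
  have \<phi>: "fst (\<phi> i j a) k = (if k = j then a else \<one>)" "snd (\<phi> i j a) k = j" if "k \<in> {1..n}" for i j a k
    using that by (simp_all add: \<phi>_def)
  define N where "N = carrier M - {\<one>}"
  define A where "A = insert (\<epsilon> 1 2 \<one>) (\<phi> 1 2 ` N \<union> \<phi> 2 1 ` N)"
  have \<phi>_W: "\<phi> i j a \<in> W" if "i \<in> {1..n}" "j \<in> {1..n}" "i \<noteq> j" "a \<in> carrier M" for i j a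
  proof -
    have "\<exists>i'\<in>{1..n}. \<exists>j'\<in>{1..n}. i' \<noteq> j' \<and> snd (\<phi> i j a) i' = snd (\<phi> i j a) j'"
      using that by (intro bexI[of _ i] bexI[of _ j]) (auto simp: \<phi> simp del: atLeastAtMost_iff)
    then show ?thesis
      using that by (auto simp: mem_W_iff \<phi>_def)
  qed
  have two: "k = i \<or> k = j" if "i \<in> {1..n}" "j \<in> {1..n}" "i \<noteq> j" "k \<in> {1..n}" for i j k
    using that assms(2) by auto
  have 12: "(1::nat) \<in> {1..n}" "(2::nat) \<in> {1..n}"
    using assms(2) by auto
  \<comment> \<open>The first factor lands in \<open>j\<close>, where the second has weight
    \<open>\<one>\<close> and moves on to \<open>i\<close>.\<close>
  have \<phi>\<phi>: "\<phi> i j a \<star> \<phi> j i a = \<epsilon> i j a" if "i \<in> {1..n}" "j \<in> {1..n}" "i \<noteq> j" "a \<in> carrier M" for i j a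
    by (rule W_eqI) (use that two[OF that(1-3)] in
        \<open>force simp: \<phi> mult_closed \<phi>_W \<epsilon>_in_W simp del: atLeastAtMost_iff\<close>)+
  obtain a where a: "a \<in> N"
  proof -
    have "carrier M \<noteq> {\<one>}"
      using assms(4) by auto
    then show ?thesis
      using that one_closed by (auto simp: N_def)
  qed
  \<comment> \<open>The weight \<open>a\<close> sits at \<open>2\<close>, off the image of the first
    factor, so any element of \<open>N\<close> moves the image from \<open>1\<close> to
    \<open>2\<close> at no cost.\<close>
  have "\<epsilon> 1 2 \<one> \<star> \<phi> 1 2 a = \<epsilon> 2 1 \<one>"
    by (rule W_eqI) (use a 12 two[OF 12] in
        \<open>force simp: N_def \<phi> mult_closed \<phi>_W \<epsilon>_in_W simp del: atLeastAtMost_iff\<close>)+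
  moreover have mem: "\<epsilon> 1 2 \<one> \<in> gen A" "b \<in> N \<Longrightarrow> \<phi> 1 2 b \<in> gen A" "b \<in> N \<Longrightarrow> \<phi> 2 1 b \<in> gen A" for b
    by (auto simp: A_def intro: semigroup_generated.incl)
  ultimately have one: "\<epsilon> 2 1 \<one> \<in> gen A"
    using a by (metis semigroup_generated.mult)
  have "generates_semigroup W (wreath_mult M n) A"
  proof (rule generates_if_\<epsilon>[OF assms(1)])
    show "A \<subseteq> W"
      using 12 by (auto simp: A_def N_def intro!: \<phi>_W \<epsilon>_in_W)
    fix i j b assume ij: "i \<in> {1..n}" "j \<in> {1..n}" "i \<noteq> j" and b: "b \<in> carrier M"
    then have ij2: "i = 1 \<and> j = 2 \<or> i = 2 \<and> j = 1"
      using assms by auto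
    show "\<epsilon> i j b \<in> gen A"
    proof (cases "b = \<one>")
      case True
      then show ?thesis
        using ij2 one mem by auto
    next
      case False
      then have "\<phi> i j b \<in> gen A" "\<phi> j i b \<in> gen A"
        using ij2 b mem(2,3)[of b] by (auto simp: N_def)
      then show ?thesis
        using \<phi>\<phi>[OF ij b] by (metis semigroup_generated.mult)
    qed
  qed
  moreover have "finite A"
    by (simp add: A_def N_def finite_carrier)
  moreover have "card A \<le> 2 * card (carrier M) - 1"
  proof -
    have N: "finite N" "card N = card (carrier M) - 1"
      by (simp_all add: N_def finite_carrier)
    have "card A \<le> Suc (card (\<phi> 1 2 ` N \<union> \<phi> 2 1 ` N))"
      unfolding A_def using N by (simp add: card_insert_if)
    also have "\<dots> \<le> Suc (card N + card N)"
      using card_Un_le[of "\<phi> 1 2 ` N" "\<phi> 2 1 ` N"] card_image_le[OF N(1), of "\<phi> 1 2"]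
        card_image_le[OF N(1), of "\<phi> 2 1"] by linarith
    also have "\<dots> \<le> 2 * card (carrier M) - 1"
    proof -
      have "card (carrier M) \<noteq> 0"
        using one_closed finite_carrier by auto
      then show ?thesis
        using N(2) by linarith
    qed
    finally show ?thesis .
  qed
  ultimately show ?thesis
    by blast
qed

text \<open>Here \<open>W\<close> consists of the two constant maps with trivial weights, so the
  bound for idempotent generators applies to every generating set.\<close>

lemma singleton_idempotent:
  assumes "n = 2" "card (carrier M) = 1"
  shows "W \<subseteq> semigroup_idempotents W (wreath_mult M n)"
proof
  fix x assume x: "x \<in> W"
  have one: "a = \<one>" if "a \<in> carrier M" for a
    using assms(2) that one_closed by (metis card_1_singletonE singletonD)
  have const: "snd x k = snd x l" if "k \<in> {1..n}" "l \<in> {1..n}" for k l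
  proof -
    obtain i j where ij: "i \<in> {1..n}" "j \<in> {1..n}" "i \<noteq> j" "snd x i = snd x j"
      using x unfolding mem_W_iff by blast
    then have "k = i \<or> k = j" "l = i \<or> l = j"
      using that assms(1) by auto
    then show ?thesis
      using ij by auto
  qed
  have "x \<star> x = x"
  proof (rule W_eqI[OF mult_closed[OF x x] x])
    fix k assume k: "k \<in> {1..n}"
    show "fst (x \<star> x) k = fst x k"
      using one[OF W_weight[OF mult_closed[OF x x] k]] one[OF W_weight[OF x k]] by simp
    show "snd (x \<star> x) k = snd x k"
      using snd_mult[OF k, of x x] const[OF W_map[OF x k] k] by simp
  qed
  then show "x \<in> semigroup_idempotents W (wreath_mult M n)"
    using x by (simp add: semigroup_idempotents_iff)
qed

end

section \<open>Evaluation of the two ranks\<close>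

lemma semigroup_rank_eqI:
  assumes "finite A" "generates_semigroup S f A" "card A \<le> r"
    and "\<And>A. finite A \<Longrightarrow> generates_semigroup S f A \<Longrightarrow> r \<le> card A"
  shows "semigroup_rank S f = enat r"
  unfolding semigroup_rank_def
  by (rule antisym) (use assms in \<open>auto intro!: INF_greatest INF_lower2[of A]\<close>)

lemma semigroup_idrank_eqI:
  assumes "finite A" "A \<subseteq> semigroup_idempotents S f" "generates_semigroup S f A" "card A \<le> r"
    and "\<And>A. finite A \<Longrightarrow> A \<subseteq> semigroup_idempotents S f \<Longrightarrow> generates_semigroup S f A \<Longrightarrow> r \<le> card A"
  shows "semigroup_idrank S f = enat r"
  unfolding semigroup_idrank_def
  by (rule antisym) (use assms in \<open>auto intro!: INF_greatest INF_lower2[of A]\<close>)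

theorem theorem4p13:
  fixes M :: "('a, 'm) monoid_scheme" and n :: nat
  assumes "n \<ge> 2"
    and "monoid M"
    and "finite (carrier M)"
    and "L_chain M"
  shows "semigroup_rank (wreath_Sing_carrier M n) (wreath_mult M n) =
      enat (if n = 2 \<and> card (carrier M) = 1 then 2
            else (2 * card (carrier M) - card (Units M)) * (n choose 2))
    \<and> semigroup_idrank (wreath_Sing_carrier M n) (wreath_mult M n) =
      enat (if n = 2 \<and> card (Units M) = 1 then 2 * card (carrier M)
            else (2 * card (carrier M) - card (Units M)) * (n choose 2))"
proof -
  interpret finite_monoid_wreath M n
    using assms by (simp add: finite_monoid_wreath_def finite_monoid_wreath_axioms_def)
  let ?r = "(2 * card (carrier M) - card (Units M)) * (n choose 2)"
  \<comment> \<open>Hence the exceptional case for the rank lies inside the one for the idempotent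
    rank.\<close>
  have U: "card (Units M) = 1" if one: "card (carrier M) = 1"
  proof -
    obtain z where z: "carrier M = {z}"
      using one by (rule card_1_singletonE)
    have "Units M \<subseteq> {z}"
      unfolding z[symmetric] by (rule subsetI) (rule Units_closed)
    then have "Units M = {z}"
      using Units_one_closed subset_singletonD by (metis empty_iff)
    then show ?thesis by simp
  qed
  have sub: "A \<subseteq> W" if "generates_semigroup W (wreath_mult M n) A" for A
    using that by (simp add: generates_semigroup_def)
  show ?thesis
  proof (cases "n = 2 \<and> card (Units M) = 1")
    case True
    obtain A where A: "finite A" "A \<subseteq> semigroup_idempotents W (wreath_mult M n)"
      "generates_semigroup W (wreath_mult M n) A" "card A \<le> 2 * card (carrier M)"
      using all_\<epsilon>_generates[OF assms(4) conjunct1[OF True]] by (elim exE conjE)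
    have id: "semigroup_idrank W (wreath_mult M n) = enat (2 * card (carrier M))"
    proof (rule semigroup_idrank_eqI[OF A])
      show "2 * card (carrier M) \<le> card B" if "finite B"
        "B \<subseteq> semigroup_idempotents W (wreath_mult M n)"
        "generates_semigroup W (wreath_mult M n) B" for B
        by (rule card_idempotent_generates_ge[OF that(1,3,2)]) (use True in blast)+
    qed
    show ?thesis
    proof (cases "card (carrier M) = 1")
      case one: True
      have "semigroup_rank W (wreath_mult M n) = enat 2"
      proof (rule semigroup_rank_eqI[OF A(1,3)])
        fix B assume B: "finite B" "generates_semigroup W (wreath_mult M n) B"
        have "B \<subseteq> semigroup_idempotents W (wreath_mult M n)"
          by (rule order.trans[OF sub[OF B(2)] singleton_idempotent]) (use True one in blast)+
        from card_idempotent_generates_ge[OF B this] show "2 \<le> card B"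
          using True one by simp
      qed (use A(4) one in simp)
      then show ?thesis
        using id True one by simp
    next
      case False
      obtain B where B: "finite B" "generates_semigroup W (wreath_mult M n) B"
        "card B \<le> 2 * card (carrier M) - 1"
        using nonidempotent_generates[OF assms(4) conjunct1[OF True] conjunct2[OF True] False]
        by (elim exE conjE)
      then have "semigroup_rank W (wreath_mult M n) = enat ?r"
        by (intro semigroup_rank_eqI[OF B(1,2)] card_generates_ge) (use B(3) True in simp)
      then show ?thesis
        using id True False by simp
    qed
  next
    case False
    \<comment> \<open>One set of idempotents meets the general lower bound and settles both
      ranks.\<close>
    obtain d where d: "generates_semigroup W (wreath_mult M n) (choice_set d)"
    proof (cases "card (Units M) = 1")
      case True
      then have "n \<ge> 3"
        using False assms(1) by linarith
      then show ?thesis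
        using choice_set_generates_trivial_units[OF assms(4) True] that by blast
    qed (use choice_set_generates_nontrivial_units[OF assms(4)] that in blast)
    have "semigroup_rank W (wreath_mult M n) = enat ?r"
      by (rule semigroup_rank_eqI[OF finite_choice_set d card_choice_set card_generates_ge])
    moreover have "semigroup_idrank W (wreath_mult M n) = enat ?r"
      by (rule semigroup_idrank_eqI[OF finite_choice_set choice_set_idempotent d card_choice_set
            card_generates_ge])
    ultimately show ?thesis
      using False U by auto
  qed
qed

end
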